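(* Let $K\subset\mathbb{R}$ be an open interval and let $\varphi:K\to\mathbb{R}$ be continuous with $0\le\varphi\le\frac{\pi}{2}$. Let $a<b$ be real numbers with $a,\ a+e^{i\varphi}(b-a)\in K$, and let $f:K\to(0,\infty)$ be a twice differentiable mapping such that $f''$ is integrable on $[a,a+e^{i\varphi}(b-a)]$. If $|f''|$ is a $\varphi$-convex function on $[a,a+e^{i\varphi}(b-a)]$, then $$\left|\frac{1}{e^{i\varphi}(b-a)}\int_a^{a+e^{i\varphi}(b-a)}f(x)\,dx-\frac{f(a)+f(a+e^{i\varphi}(b-a))}{2}\right|\le\frac{e^{2i\varphi}(b-a)^2}{24}\Big[|f''(a)|+|f''(b)|\Big].$$
   Context: Here $i$ is the imaginary unit. In an expression $u+te^{i\varphi}(v-u)$ the argument of $\varphi$ is suppressed and $\varphi$ is read as its value at the base point $u$; thus $a+e^{i\varphi}(b-a)$ uses $\varphi=\varphi(a)$. Since $a+e^{i\varphi}(b-a)$ is an endpoint of a real interval, it is understood to be a real number. A set $S$ is $\varphi$-convex if $u+te^{i\varphi}(v-u)\in S$ for all $u,v\in S$ and $t\in[0,1]$. A real-valued function $g$ on a $\varphi$-convex set $S$ is $\varphi$-convex if $g(u+te^{i\varphi}(v-u))\le(1-t)g(u)+t\,g(v)$ for all $u,v\in S$, $t\in[0,1]$. Saying that $g$ is $\varphi$-convex on a set includes that the set is $\varphi$-convex. *)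

theory Defs
  imports "HOL-Analysis.Analysis" "HOL-Library.Complex_Order"
begin

(* Inequalities between complex numbers are those of Complex_Order: equal imaginary parts
   and ordered real parts. A bound of a real number by a complex expression therefore
   includes that the expression is real. *)

(* The point u + t e^(i phi(u)) (v - u): phi is evaluated at the base point u, and the
   point is a complex number which in general does not lie on the real line. *)
definition phi_point :: "(real \<Rightarrow> real) \<Rightarrow> real \<Rightarrow> real \<Rightarrow> real \<Rightarrow> complex" where
  "phi_point \<phi> u v t =
     complex_of_real u
       + complex_of_real t * exp (\<i> * complex_of_real (\<phi> u)) * complex_of_real (v - u)"

definition phi_convex_set :: "(real \<Rightarrow> real) \<Rightarrow> real set \<Rightarrow> bool" where
  "phi_convex_set \<phi> S \<longleftrightarrow>
     (\<forall>u\<in>S. \<forall>v\<in>S. \<forall>t\<in>{0..1}. phi_point \<phi> u v t \<in> complex_of_real ` S)"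

(* Since S is a phi-convex set of reals, every point occurring below is real, so Re only
   converts it to type real. *)
definition phi_convex_on :: "(real \<Rightarrow> real) \<Rightarrow> real set \<Rightarrow> (real \<Rightarrow> real) \<Rightarrow> bool" where
  "phi_convex_on \<phi> S g \<longleftrightarrow>
     phi_convex_set \<phi> S \<and>
     (\<forall>u\<in>S. \<forall>v\<in>S. \<forall>t\<in>{0..1}. g (Re (phi_point \<phi> u v t)) \<le> (1 - t) * g u + t * g v)"

end

theory Submission
  imports Defs
begin

text \<open>
  Since the endpoint is real, \<open>sin (\<phi> a) = 0\<close>, so the range condition on \<open>\<phi>\<close> forces
  \<open>\<phi> a = 0\<close>: the endpoint is \<open>b\<close> itself, and \<open>\<phi>\<close>-convexity with base point \<open>a\<close> bounds
  \<open>\<bar>f''\<bar>\<close> on \<open>[a, b]\<close> by its linear interpolant at \<open>a\<close> and \<open>b\<close>.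
  What remains is the estimate of the trapezoidal error by the Peano kernel,
  \<open>(b - a) (f a + f b) / 2 - \<integral> f = 1/2 \<integral> (x - a) (b - x) f'' x dx\<close>.
\<close>

text \<open>Up to \<open>2 f\<close>, the integrand is the derivative of
  \<open>(x - a) (b - x) f' x - (a + b - 2 x) f x\<close>, which also yields its integrability.\<close>
lemma trapezoid_peano_kernel:
  fixes f f' f'' :: "real \<Rightarrow> real" and a b :: real
  assumes "a \<le> b"
    and f': "\<And>x. x \<in> {a..b} \<Longrightarrow> (f has_real_derivative f' x) (at x within {a..b})"
    and f'': "\<And>x. x \<in> {a..b} \<Longrightarrow> (f' has_real_derivative f'' x) (at x within {a..b})"
  shows "((\<lambda>x. (x - a) * (b - x) * f'' x) has_integral
           (b - a) * (f a + f b) - 2 * integral {a..b} f) {a..b}"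
proof -
  let ?P = "\<lambda>x. (x - a) * (b - x) * f' x - (a + b - 2 * x) * f x"
  have "((\<lambda>x. (x - a) * (b - x) * f'' x + 2 * f x) has_integral ?P b - ?P a) {a..b}"
  proof (rule fundamental_theorem_of_calculus[OF \<open>a \<le> b\<close>])
    fix x assume "x \<in> {a..b}"
    then have "(?P has_real_derivative (x - a) * (b - x) * f'' x + 2 * f x) (at x within {a..b})"
      by - ((rule derivative_eq_intros f' f'' refl | assumption)+, simp add: algebra_simps)
    then show "(?P has_vector_derivative (x - a) * (b - x) * f'' x + 2 * f x) (at x within {a..b})"
      by (simp add: has_real_derivative_iff_has_vector_derivative)
  qed
  moreover have "f integrable_on {a..b}"
    using f' by (intro integrable_continuous_real DERIV_continuous_on)
  then have "((\<lambda>x. 2 * f x) has_integral 2 * integral {a..b} f) {a..b}"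
    by (intro has_integral_mult_right integrable_integral)
  ultimately have "((\<lambda>x. (x - a) * (b - x) * f'' x + 2 * f x - 2 * f x) has_integral
      ?P b - ?P a - 2 * integral {a..b} f) {a..b}"
    by (rule has_integral_diff)
  \<comment> \<open>The weight \<open>(x - a) * (b - x)\<close> vanishes at both ends, so
    \<open>f'\<close> drops out of the boundary terms and only \<open>(b - a) * (f a + f b)\<close>
    survives.\<close>
  then show ?thesis by (simp add: algebra_simps)
qed

text \<open>Integrates the kernel against the linear interpolant; the factor 1 / (b - a) of the
  latter is left out here and later absorbed into \<open>A\<close> and \<open>B\<close>.\<close>

lemma has_integral_kernel_linear:
  fixes a b A B :: real
  assumes "a \<le> b"
  shows "((\<lambda>x. (x - a) * (b - x) * ((b - x) * A + (x - a) * B)) has_integral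
           (b - a) ^ 4 / 12 * (A + B)) {a..b}"
proof -
  define h where "h = b - a"
  \<comment> \<open>Expand in powers of s = x - a with b - x = h - s, then integrate termwise.
    \<open>?Q\<close> vanishes at \<open>a\<close>, and at \<open>b\<close> both coefficients are
    h^4 / 12, since 1/2 - 2/3 + 1/4 = 1/3 - 1/4 = 1/12.\<close>
  let ?Q = "\<lambda>x. A * (h\<^sup>2 / 2 * (x - a)\<^sup>2 - 2 * h / 3 * (x - a) ^ 3 + 1 / 4 * (x - a) ^ 4)
                 + B * (h / 3 * (x - a) ^ 3 - 1 / 4 * (x - a) ^ 4)"
  have "((\<lambda>x. (x - a) * (b - x) * ((b - x) * A + (x - a) * B)) has_integral
      ?Q b - ?Q a) {a..b}"
  proof (rule fundamental_theorem_of_calculus[OF assms])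
    fix x
    have "(?Q has_real_derivative
        A * (h\<^sup>2 * (x - a) - 2 * h * (x - a)\<^sup>2 + (x - a) ^ 3)
         + B * (h * (x - a)\<^sup>2 - (x - a) ^ 3)) (at x within {a..b})"
      by ((rule derivative_eq_intros refl)+, simp add: algebra_simps)
    also have "A * (h\<^sup>2 * (x - a) - 2 * h * (x - a)\<^sup>2 + (x - a) ^ 3)
         + B * (h * (x - a)\<^sup>2 - (x - a) ^ 3)
       = (x - a) * (b - x) * ((b - x) * A + (x - a) * B)"
      unfolding h_def by algebra
    finally show "(?Q has_vector_derivative
        (x - a) * (b - x) * ((b - x) * A + (x - a) * B)) (at x within {a..b})"
      by (simp add: has_real_derivative_iff_has_vector_derivative)
  qed
  moreover have "?Q b - ?Q a = h ^ 4 / 12 * (A + B)"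
    unfolding h_def[symmetric]
    by (simp add: algebra_simps power2_eq_square power3_eq_cube power4_eq_xxxx)
  ultimately show ?thesis by (simp only: h_def)
qed

text \<open>The kernel is nonnegative on [a, b], so a pointwise bound on \<open>f''\<close> carries
  over to the integral. This gives (b - a)^3 / 12 * (A + B) for twice the unnormalised error;
  dividing by 2 (b - a) produces the constant 1/24.\<close>

lemma trapezoid_error_bound:
  fixes f f' f'' :: "real \<Rightarrow> real" and a b A B :: real
  assumes "a < b"
    and f': "\<And>x. x \<in> {a..b} \<Longrightarrow> (f has_real_derivative f' x) (at x within {a..b})"
    and f'': "\<And>x. x \<in> {a..b} \<Longrightarrow> (f' has_real_derivative f'' x) (at x within {a..b})"
    and bound: "\<And>x. x \<in> {a..b} \<Longrightarrow> \<bar>f'' x\<bar> \<le> ((b - x) * A + (x - a) * B) / (b - a)"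
  shows "\<bar>integral {a..b} f / (b - a) - (f a + f b) / 2\<bar> \<le> (b - a)\<^sup>2 / 24 * (A + B)"
proof -
  let ?w = "\<lambda>x. (x - a) * (b - x)"
  let ?E = "(b - a) * (f a + f b) - 2 * integral {a..b} f"
  have kernel: "((\<lambda>x. ?w x * f'' x) has_integral ?E) {a..b}"
    using \<open>a < b\<close> f' f'' by (intro trapezoid_peano_kernel) auto
  \<comment> \<open>Stated for a generic positive \<open>h\<close>, so that b - a is cancelled as a
    single atom instead of being expanded.\<close>
  have "h ^ 4 / 12 * (A / h + B / h) = h ^ 3 / 12 * (A + B)" if "h > 0" for h :: real
    using that by (simp add: field_simps power4_eq_xxxx power3_eq_cube)
  from this[of "b - a"]
  have "(b - a) ^ 4 / 12 * (A / (b - a) + B / (b - a)) = (b - a) ^ 3 / 12 * (A + B)"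
    using \<open>a < b\<close> by (simp only: diff_gt_0_iff_gt)
  then have dominant: "((\<lambda>x. ?w x * (((b - x) * A + (x - a) * B) / (b - a))) has_integral
      (b - a) ^ 3 / 12 * (A + B)) {a..b}"
    using has_integral_kernel_linear[of a b "A / (b - a)" "B / (b - a)"] \<open>a < b\<close>
    by (simp add: add_divide_distrib)
  have "norm (?w x * f'' x) \<le> ?w x * (((b - x) * A + (x - a) * B) / (b - a))"
    if "x \<in> {a..b}" for x
  proof -
    have "?w x \<ge> 0" using that by simp
    then have "norm (?w x * f'' x) = ?w x * \<bar>f'' x\<bar>"
      by (simp only: real_norm_def abs_mult[of "?w x"] abs_of_nonneg)
    then show ?thesis
      using mult_left_mono[OF bound[OF that] \<open>?w x \<ge> 0\<close>] by (simp only:)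
  qed
  then have "norm ?E \<le> (b - a) ^ 3 / 12 * (A + B)"
    using integral_norm_bound_integral[OF has_integral_integrable[OF kernel]
        has_integral_integrable[OF dominant]]
    by (simp only: integral_unique[OF kernel] integral_unique[OF dominant])
  then have "norm ?E / (2 * (b - a)) \<le> (b - a) ^ 3 / 12 * (A + B) / (2 * (b - a))"
    using \<open>a < b\<close> by (intro divide_right_mono) auto
  moreover have "integral {a..b} f / (b - a) - (f a + f b) / 2 = - (?E / (2 * (b - a)))"
    using \<open>a < b\<close> by (simp add: field_simps)
  then have "\<bar>integral {a..b} f / (b - a) - (f a + f b) / 2\<bar> = norm ?E / (2 * (b - a))"
    using \<open>a < b\<close> by (simp only: abs_minus_cancel abs_divide real_norm_def) simp
  ultimately have "\<bar>integral {a..b} f / (b - a) - (f a + f b) / 2\<bar>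
      \<le> (b - a) ^ 3 / 12 * (A + B) / (2 * (b - a))"
    by (simp only:)
  also have "\<dots> = (b - a)\<^sup>2 / 24 * (A + B)"
  proof -
    have "h ^ 3 / 12 * (A + B) / (2 * h) = h\<^sup>2 / 24 * (A + B)" if "h > 0" for h :: real
      using that by (simp add: field_simps power2_eq_square power3_eq_cube)
    then show ?thesis
      using \<open>a < b\<close> by (simp only: diff_gt_0_iff_gt)
  qed
  finally show ?thesis .
qed

theorem theorem6:
  fixes K :: "real set" and \<phi> f :: "real \<Rightarrow> real" and a b c :: real
  assumes "open K" and "is_interval K"
    and "continuous_on K \<phi>"
    and "\<forall>x\<in>K. 0 \<le> \<phi> x \<and> \<phi> x \<le> pi / 2"
    and "a < b"
    and "complex_of_real c =
           complex_of_real a + exp (\<i> * complex_of_real (\<phi> a)) * complex_of_real (b - a)"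
    and "a \<in> K" and "c \<in> K"
    and "\<forall>x\<in>K. 0 < f x"
    and "\<forall>x\<in>K. f differentiable (at x)"
    and "\<forall>x\<in>K. deriv f differentiable (at x)"
    and "set_integrable lborel {a..c} (deriv (deriv f))"
    and "phi_convex_on \<phi> {a..c} (\<lambda>x. \<bar>deriv (deriv f) x\<bar>)"
  shows "complex_of_real
           (cmod (1 / (exp (\<i> * complex_of_real (\<phi> a)) * complex_of_real (b - a))
                    * complex_of_real (integral {a..c} f)
                  - complex_of_real ((f a + f c) / 2)))
         \<le> exp (2 * \<i> * complex_of_real (\<phi> a)) * complex_of_real ((b - a)\<^sup>2) / 24
             * complex_of_real (\<bar>deriv (deriv f) a\<bar> + \<bar>deriv (deriv f) b\<bar>)"
proof -
  have phi_range: "0 \<le> \<phi> a" "\<phi> a \<le> pi / 2"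
    using assms(4,7) by auto
  \<comment> \<open>\<open>c\<close> and \<open>a\<close> are real, so comparing imaginary parts
    isolates the sine.\<close>
  have "sin (\<phi> a) * (b - a) = 0"
    using arg_cong[OF assms(6), of Im] by (simp add: Im_exp)
  then have "sin (\<phi> a) = 0"
    using \<open>a < b\<close> by simp
  then have phi: "\<phi> a = 0"
    using phi_range sin_gt_zero[of "\<phi> a"] pi_gt_zero by linarith
  have "c = b"
    using arg_cong[OF assms(6), of Re] phi by simp
  note deriv_at = DERIV_deriv_iff_real_differentiable[THEN iffD2]
  have sub: "{a..b} \<subseteq> K"
    using mem_is_interval_1_I[OF assms(2,7,8)] \<open>c = b\<close> by auto
  have "\<bar>integral {a..b} f / (b - a) - (f a + f b) / 2\<bar>
      \<le> (b - a)\<^sup>2 / 24 * (\<bar>deriv (deriv f) a\<bar> + \<bar>deriv (deriv f) b\<bar>)"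
  proof (rule trapezoid_error_bound[OF \<open>a < b\<close>])
    fix x assume x: "x \<in> {a..b}"
    then have "x \<in> K" using sub by blast
    then show "(f has_real_derivative deriv f x) (at x within {a..b})"
      and "(deriv f has_real_derivative deriv (deriv f) x) (at x within {a..b})"
      using assms(10,11) by (auto intro!: has_field_derivative_at_within deriv_at)
    \<comment> \<open>As \<open>\<phi> a = 0\<close>, the path from \<open>a\<close> to
      \<open>b\<close> is the straight segment, and \<open>t\<close> is the parameter at which it
      passes through \<open>x\<close>.\<close>
    define t where "t = (x - a) / (b - a)"
    have "t \<in> {0..1}" using x \<open>a < b\<close> by (simp add: t_def)
    moreover have "Re (phi_point \<phi> a b t) = x"
      using \<open>a < b\<close> by (simp add: phi_point_def phi t_def)
    ultimately have "\<bar>deriv (deriv f) x\<bar>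
        \<le> (1 - t) * \<bar>deriv (deriv f) a\<bar> + t * \<bar>deriv (deriv f) b\<bar>"
      using assms(13) \<open>a < b\<close> \<open>c = b\<close> unfolding phi_convex_on_def by fastforce
    also have "\<dots> = ((b - x) * \<bar>deriv (deriv f) a\<bar> + (x - a) * \<bar>deriv (deriv f) b\<bar>) / (b - a)"
    proof -
      have "1 - t = (b - x) / (b - a)"
        using \<open>a < b\<close> by (simp add: t_def field_simps)
      then show ?thesis
        by (simp add: t_def add_divide_distrib)
    qed
    finally show "\<bar>deriv (deriv f) x\<bar>
        \<le> ((b - x) * \<bar>deriv (deriv f) a\<bar> + (x - a) * \<bar>deriv (deriv f) b\<bar>) / (b - a)" .
  qed
  moreover have "cmod (1 / (exp (\<i> * complex_of_real (\<phi> a)) * complex_of_real (b - a))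
        * complex_of_real (integral {a..c} f) - complex_of_real ((f a + f c) / 2))
      = \<bar>integral {a..b} f / (b - a) - (f a + f b) / 2\<bar>"
  proof -
    have "1 / (exp (\<i> * complex_of_real (\<phi> a)) * complex_of_real (b - a))
        * complex_of_real (integral {a..c} f) - complex_of_real ((f a + f c) / 2)
      = complex_of_real (integral {a..b} f / (b - a) - (f a + f b) / 2)"
      by (simp add: phi \<open>c = b\<close>)
    then show ?thesis by (simp only: norm_of_real)
  qed
  moreover have "exp (2 * \<i> * complex_of_real (\<phi> a)) * complex_of_real ((b - a)\<^sup>2) / 24
        * complex_of_real (\<bar>deriv (deriv f) a\<bar> + \<bar>deriv (deriv f) b\<bar>)
      = complex_of_real ((b - a)\<^sup>2 / 24 * (\<bar>deriv (deriv f) a\<bar> + \<bar>deriv (deriv f) b\<bar>))"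
    by (simp add: phi)
  \<comment> \<open>Both sides are now embedded reals: the imaginary parts agree, and the complex
    order reduces to the real bound.\<close>
  ultimately show ?thesis
    by (simp only: less_eq_complex_def Re_complex_of_real Im_complex_of_real)
qed

end
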